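(* Suppose $Q$ is a log-concave distribution on $\mathbb{N}=\{1,2,\ldots\}$. (i) The compound Bernoulli distribution $\mathrm{CBern}(p,Q)$ is log-concave if and only if $$p\ge\frac{1}{1+Q(1)^2/Q(2)}.$$ (ii) The compound Bernoulli sum distribution $C_Qb_{\mathbf p}$ is log-concave as long as all the elements $p_i$ of the parameter vector $\mathbf p=(p_1,p_2,\ldots,p_n)$ satisfy $$p_i\ge\frac{1}{1+Q(1)^2/Q(2)}.$$
   Context: A distribution $P$ on $\mathbb{Z}_+=\{0,1,2,\ldots\}$ is log-concave if its support is a (possibly infinite) interval of successive integers in $\mathbb{Z}_+$ and $P(x)^2\ge P(x+1)P(x-1)$ for all $x\ge1$. A distribution on $\mathbb{N}$ is regarded as a distribution on $\mathbb{Z}_+$ with mass $0$ at $0$. For $0\le p\le1$, $\mathrm{CBern}(p,Q)$ is the distribution of the product $BX$, where $B\sim\mathrm{Bern}(p)$ and $X\sim Q$ are independent; it has mass $1-p$ at $0$ and mass $pQ(x)$ at each $x\ge1$. For a parameter vector $\mathbf p=(p_1,\ldots,p_n)$ with each $p_i\in[0,1]$, $b_{\mathbf p}$ is the probability mass function of $\sum_{i=1}^nB_i$, where the $B_i\sim\mathrm{Bern}(p_i)$ are independent. For a distribution $P$ on $\mathbb{Z}_+$, the $Q$-compound distribution is $C_QP(x)=\sum_{y=0}^\infty P(y)Q^{*y}(x)$, $x\ge0$, where $Q^{*y}$ is the $y$-th convolution power of $Q$ and $Q^{*0}$ is the point mass at $0$. Thus $C_Qb_{\mathbf p}$ is the distribution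 of $\sum_{i=1}^nB_iX_i$ with $X_1,\ldots,X_n$ i.i.d. with distribution $Q$, independent of the $B_i$.
   Formalization: In (i), "only if" is stated for p ≠ 0 only: CBern(0,Q) is the point mass at 0, log-concave for every Q, though the threshold is positive unless Q is the point mass at 1. The threshold is read as 0 if Q(2)=0<Q(1) and as 1 if Q(1)=Q(2)=0. *)

theory Defs
  imports "HOL-Probability.Probability"
begin

text \<open>A distribution on the nonnegative integers is a \<open>nat pmf\<close>; it is a distribution on
  \<open>{1, 2, \<dots>}\<close> if its mass at \<open>0\<close> vanishes.\<close>

definition log_concave_pmf :: "nat pmf \<Rightarrow> bool" where
  "log_concave_pmf P \<longleftrightarrow>
     (\<forall>x y z. x \<in> set_pmf P \<and> z \<in> set_pmf P \<and> x \<le> y \<and> y \<le> z \<longrightarrow> y \<in> set_pmf P) \<and>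
     (\<forall>x\<ge>1. (pmf P x)\<^sup>2 \<ge> pmf P (x + 1) * pmf P (x - 1))"

definition cbern_pmf :: "real \<Rightarrow> nat pmf \<Rightarrow> nat pmf" where
  "cbern_pmf p Q = map_pmf (\<lambda>(b, x). of_bool b * x) (pair_pmf (bernoulli_pmf p) Q)"

definition bernoulli_sum_pmf :: "nat \<Rightarrow> (nat \<Rightarrow> real) \<Rightarrow> nat pmf" where
  "bernoulli_sum_pmf n p =
     map_pmf (\<lambda>B. \<Sum>i\<in>{1..n}. of_bool (B i)) (Pi_pmf {1..n} False (\<lambda>i. bernoulli_pmf (p i)))"

definition conv_pmf :: "nat pmf \<Rightarrow> nat pmf \<Rightarrow> nat pmf" where
  "conv_pmf P Q = map_pmf (\<lambda>(x, y). x + y) (pair_pmf P Q)"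

primrec conv_power_pmf :: "nat pmf \<Rightarrow> nat \<Rightarrow> nat pmf" where
  "conv_power_pmf Q 0 = return_pmf 0"
| "conv_power_pmf Q (Suc n) = conv_pmf Q (conv_power_pmf Q n)"

definition compound_pmf :: "nat pmf \<Rightarrow> nat pmf \<Rightarrow> nat pmf" where
  "compound_pmf Q P = bind_pmf P (conv_power_pmf Q)"

text \<open>The threshold is taken in \<open>ennreal\<close> so that it has its intended value \<open>0\<close> when
  \<open>Q(2) = 0 < Q(1)\<close>, i.e. when \<open>Q\<close> is the point mass at \<open>1\<close>; division in \<open>real\<close> would give \<open>1\<close>.
  If \<open>Q(1) = Q(2) = 0\<close>, the convention \<open>0 / 0 = 0\<close> of \<open>ennreal\<close> makes it \<open>1\<close>, the same value as
  for \<open>Q(1) = 0 < Q(2)\<close>.\<close>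

definition cbern_threshold :: "nat pmf \<Rightarrow> ennreal" where
  "cbern_threshold Q = 1 / (1 + (ennreal (pmf Q 1))\<^sup>2 / ennreal (pmf Q 2))"

lemma compound_pmf_sums:
  "(\<lambda>y. pmf P y * pmf (conv_power_pmf Q y) x) sums pmf (compound_pmf Q P) x"
proof -
  have s: "summable (\<lambda>y. pmf P y * pmf (conv_power_pmf Q y) x)"
  proof (rule summable_comparison_test')
    show "summable (pmf P)"
      using pmf_abs_summable[of P UNIV] by (simp add: abs_summable_on_nat_iff')
    show "norm (pmf P y * pmf (conv_power_pmf Q y) x) \<le> pmf P y" if "y \<ge> 0" for y
      by (simp add: mult_left_le pmf_le_1)
  qed
  have "pmf (compound_pmf Q P) x = infsetsum (\<lambda>y. pmf P y * pmf (conv_power_pmf Q y) x) UNIV"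
    unfolding compound_pmf_def pmf_bind by (simp add: pmf_expectation_eq_infsetsum)
  also have "\<dots> = (\<Sum>y. pmf P y * pmf (conv_power_pmf Q y) x)"
    using s by (intro infsetsum_nat') (simp add: abs_summable_on_nat_iff')
  finally show ?thesis using s by (simp add: sums_iff)
qed

lemma pmf_cbern_pmf:
  assumes "0 \<le> p" "p \<le> 1" "x \<ge> 1"
  shows "pmf (cbern_pmf p Q) x = p * pmf Q x"
proof -
  have "cbern_pmf p Q = bind_pmf (bernoulli_pmf p) (\<lambda>b. if b then Q else return_pmf 0)"
    unfolding cbern_pmf_def pair_pmf_def map_bind_pmf
    by (intro bind_pmf_cong refl) (auto simp: map_bind_pmf bind_return_pmf bind_return_pmf')
  then show ?thesis using assms by (simp add: pmf_bind)
qed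

lemma cbern_threshold_real:
  assumes "pmf Q 2 > 0"
  shows "cbern_threshold Q = ennreal (1 / (1 + (pmf Q 1)\<^sup>2 / pmf Q 2))"
proof -
  have "1 + (ennreal (pmf Q 1))\<^sup>2 / ennreal (pmf Q 2) = ennreal (1 + (pmf Q 1)\<^sup>2 / pmf Q 2)"
    using assms by (simp add: ennreal_power divide_ennreal ennreal_plus flip: ennreal_1)
  moreover have "1 + (pmf Q 1)\<^sup>2 / pmf Q 2 > 0"
    using assms by (intro add_pos_nonneg) auto
  ultimately show ?thesis
    unfolding cbern_threshold_def by (simp only: divide_ennreal zero_le_one flip: ennreal_1)
qed

lemma cbern_threshold_eq_0:
  assumes "pmf Q 1 > 0" "pmf Q 2 = 0"
  shows "cbern_threshold Q = 0"
  using assms by (simp add: cbern_threshold_def ennreal_divide_zero ennreal_power)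

lemma cbern_threshold_eq_1:
  assumes "pmf Q 1 = 0"
  shows "cbern_threshold Q = 1"
  using assms by (simp add: cbern_threshold_def divide_ennreal_def)

end

theory Submission
  imports Defs
begin

text \<open>Extended by \<open>0\<close> to \<open>\<int>\<close>, a mass function \<open>f\<close> is log-concave (with interval support) iff
  its Toeplitz matrix \<open>f (i - j)\<close> has nonnegative \<open>2 \<times> 2\<close> minors. By the Cauchy--Binet formula this
  property passes to products of matrices, so log-concave distributions are closed under convolution.
  Now (i) only concerns the inequality at \<open>x = 1\<close>, and (ii) follows because \<open>C\<^sub>Q b\<^sub>p\<close> is the
  convolution of the distributions \<open>CBern(p\<^sub>i, Q)\<close>.\<close>

section \<open>Log-concavity as nonnegativity of Toeplitz minors\<close>

definition int_mass :: "nat pmf \<Rightarrow> int \<Rightarrow> real" where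
  "int_mass P x = (if x < 0 then 0 else pmf P (nat x))"

text \<open>For nonnegative \<open>f\<close> this is the Polya frequency condition of order
  2.\<close>

definition toeplitz_tp2 :: "(int \<Rightarrow> real) \<Rightarrow> bool" where
  "toeplitz_tp2 f \<longleftrightarrow>
     (\<forall>i i' j j'. i \<le> i' \<and> j \<le> j' \<longrightarrow> f (i - j') * f (i' - j) \<le> f (i - j) * f (i' - j'))"

lemma int_mass_of_nat [simp]: "int_mass P (int x) = pmf P x"
  by (simp add: int_mass_def)

text \<open>The arguments in a minor form an outer and an inner pair with equal sums. Rows
  \<open>0\<close>, \<open>w - x\<close> and columns \<open>- y\<close>, \<open>- x\<close> realise
  every such quadruple.\<close>

lemma toeplitz_tp2D:
  assumes "toeplitz_tp2 f" "x \<le> y" "x \<le> w" "x + z = y + w"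
  shows "f x * f z \<le> f y * f w"
proof -
  have z: "z = w + y - x" using assms(4) by simp
  show ?thesis
    unfolding z using assms(1)[unfolded toeplitz_tp2_def, rule_format, of 0 "w - x" "- y" "- x"] assms(2-3)
    by (simp add: algebra_simps)
qed

text \<open>Ratios of successive masses are nonincreasing along the support; the product form also
  covers vanishing masses.\<close>

lemma log_concave_pmf_step:
  assumes "log_concave_pmf P"
  shows "pmf P x * pmf P (x + k + 1) \<le> pmf P (x + 1) * pmf P (x + k)"
proof (induction k)
  case (Suc k)
  let ?y = "x + k"
  show ?case
  proof (cases "pmf P x * pmf P (?y + 2) = 0")
    case False
    then have "x \<in> set_pmf P" "?y + 2 \<in> set_pmf P"
      by (auto simp: set_pmf_iff)
    \<comment> \<open>Interval support makes the factor \<open>pmf P ?y\<close>, cancelled at the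
      end, positive.\<close>
    then have "?y \<in> set_pmf P"
      using assms unfolding log_concave_pmf_def by (metis le_add1)
    then have pos: "pmf P ?y > 0"
      by (simp add: pmf_positive)
    have "(pmf P x * pmf P (?y + 2)) * pmf P ?y = pmf P x * (pmf P (?y + 1 + 1) * pmf P (?y + 1 - 1))"
      by simp
    also have "\<dots> \<le> pmf P x * (pmf P (?y + 1))\<^sup>2"
      using assms unfolding log_concave_pmf_def by (intro mult_left_mono) auto
    also have "\<dots> = (pmf P x * pmf P (?y + 1)) * pmf P (?y + 1)"
      by (simp add: power2_eq_square)
    also have "\<dots> \<le> (pmf P (x + 1) * pmf P ?y) * pmf P (?y + 1)"
      using Suc by (intro mult_right_mono) auto
    also have "\<dots> = (pmf P (x + 1) * pmf P (?y + 1)) * pmf P ?y"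
      by simp
    finally show ?thesis
      using pos by simp
  next
    case True
    then have "pmf P x * pmf P (x + Suc k + 1) = 0"
      by simp
    then show ?thesis
      by (metis mult_nonneg_nonneg pmf_nonneg)
  qed
qed simp

text \<open>Iterating the one-step inequality moves the outer pair inward one unit at a
  time.\<close>

lemma log_concave_pmf_shift:
  assumes "log_concave_pmf P" "x + e \<le> w"
  shows "pmf P x * pmf P (w + e) \<le> pmf P (x + e) * pmf P w"
  using assms(2)
proof (induction e arbitrary: w)
  case (Suc e)
  have "pmf P x * pmf P (w + 1 + e) \<le> pmf P (x + e) * pmf P (w + 1)"
    using Suc by (intro Suc.IH) simp
  also have "\<dots> \<le> pmf P (x + e + 1) * pmf P w"
    using log_concave_pmf_step[OF assms(1), of "x + e" "w - (x + e)"] Suc.prems by simp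
  finally show ?case by simp
qed simp

lemma toeplitz_tp2_int_mass_iff:
  "toeplitz_tp2 (int_mass P) \<longleftrightarrow> log_concave_pmf P"
proof
  assume tp: "toeplitz_tp2 (int_mass P)"
  have ineq: "pmf P x * pmf P z \<le> pmf P y * pmf P w" if "x \<le> y" "x \<le> w" "x + z = y + w" for x y z w
    using toeplitz_tp2D[OF tp, of "int x" "int y" "int w" "int z"] that by simp
  show "log_concave_pmf P"
    unfolding log_concave_pmf_def
  proof (intro conjI allI impI)
    fix x y z assume *: "x \<in> set_pmf P \<and> z \<in> set_pmf P \<and> x \<le> y \<and> y \<le> z"
    then have "0 < pmf P x * pmf P z"
      by (simp add: pmf_positive)
    \<comment> \<open>The partner of \<open>y\<close> is its reflection \<open>x + z - y\<close>; a
      positive outer product forces a positive inner one.\<close>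
    also have "\<dots> \<le> pmf P y * pmf P (x + z - y)"
      using * by (intro ineq) auto
    finally show "y \<in> set_pmf P"
      by (auto simp: set_pmf_iff)
  next
    fix x :: nat assume "1 \<le> x"
    then show "pmf P (x + 1) * pmf P (x - 1) \<le> (pmf P x)\<^sup>2"
      using ineq[of "x - 1" x x "x + 1"] by (simp add: power2_eq_square mult.commute)
  qed
next
  assume lc: "log_concave_pmf P"
  have ordered: "pmf P x * pmf P z \<le> pmf P y * pmf P w" if "x \<le> y" "y \<le> w" "x + z = y + w" for x y z w
  proof -
    have "z = w + (y - x)" using that by simp
    then show ?thesis
      using log_concave_pmf_shift[OF lc, of x "y - x" w] that by simp
  qed
  have any: "pmf P x * pmf P z \<le> pmf P y * pmf P w" if "x \<le> y" "x \<le> w" "x + z = y + w" for x y z w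
    using ordered[of x y w z] ordered[of x w y z] that
    by (cases "y \<le> w") (auto simp: mult.commute add.commute)
  show "toeplitz_tp2 (int_mass P)"
    unfolding toeplitz_tp2_def
  proof (intro allI impI)
    fix i i' j j' :: int assume *: "i \<le> i' \<and> j \<le> j'"
    show "int_mass P (i - j') * int_mass P (i' - j) \<le> int_mass P (i - j) * int_mass P (i' - j')"
    \<comment> \<open>\<open>i - j'\<close> is the least of the four arguments: if it is negative,
      the left side vanishes; otherwise \<open>nat\<close> is faithful on all four.\<close>
    proof (cases "i - j' < 0")
      case True
      then show ?thesis
        by (simp add: int_mass_def)
    next
      case False
      then have "pmf P (nat (i - j')) * pmf P (nat (i' - j)) \<le> pmf P (nat (i - j)) * pmf P (nat (i' - j'))"
        using * by (intro any nat_mono) (simp_all flip: nat_add_distrib)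
      then show ?thesis
        using False * by (simp add: int_mass_def)
    qed
  qed
qed

section \<open>Closure under convolution\<close>

lemma pmf_conv_pmf: "pmf (conv_pmf P R) x = (\<Sum>k\<le>x. pmf P (x - k) * pmf R k)"
proof -
  have "pmf (conv_pmf P R) x = measure (pair_pmf P R) ((\<lambda>k. (x - k, k)) ` {..x})"
    unfolding conv_pmf_def pmf_map
    by (rule arg_cong[where f = "measure _"]) (force simp: image_iff)
  also have "\<dots> = (\<Sum>y\<in>(\<lambda>k. (x - k, k)) ` {..x}. pmf (pair_pmf P R) y)"
    by (intro measure_measure_pmf_finite) simp
  also have "\<dots> = (\<Sum>k\<le>x. pmf P (x - k) * pmf R k)"
    by (subst sum.reindex) (auto simp: inj_on_def pmf_pair)
  finally show ?thesis .
qed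

text \<open>The Toeplitz matrix of a convolution is the product of the Toeplitz matrices. Terms
  vanish outside \<open>{j..i}\<close>; the freedom in \<open>K\<close> lets the four entries of a
  minor share one index set, as Cauchy-Binet requires.\<close>

lemma int_mass_conv_pmf:
  assumes "finite K" "{j..i} \<subseteq> K"
  shows "int_mass (conv_pmf P R) (i - j) = (\<Sum>k\<in>K. int_mass P (i - k) * int_mass R (k - j))"
proof -
  have "(\<Sum>k\<in>K. int_mass P (i - k) * int_mass R (k - j)) =
        (\<Sum>k\<in>{j..i}. int_mass P (i - k) * int_mass R (k - j))"
    using assms by (intro sum.mono_neutral_right) (auto simp: int_mass_def)
  also have "\<dots> = int_mass (conv_pmf P R) (i - j)"
  proof (cases "i < j")
    case False
    have "(\<Sum>k\<in>{j..i}. int_mass P (i - k) * int_mass R (k - j)) =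
          (\<Sum>k\<le>nat (i - j). pmf P (nat (i - j) - k) * pmf R k)"
      using False
      by (intro sum.reindex_bij_witness[of _ "\<lambda>k. int k + j" "\<lambda>k. nat (k - j)"])
         (auto simp: int_mass_def simp flip: nat_diff_distrib)
    then show ?thesis
      using False by (simp add: int_mass_def pmf_conv_pmf)
  qed (simp add: int_mass_def)
  finally show ?thesis by simp
qed

text \<open>Cauchy--Binet, with each minor counted twice so that the sum runs over all pairs.\<close>

lemma cauchy_binet_2:
  fixes a a' b b' :: "'k \<Rightarrow> 'a::comm_ring_1"
  shows "2 * ((\<Sum>k\<in>K. a k * b k) * (\<Sum>k\<in>K. a' k * b' k) - (\<Sum>k\<in>K. a k * b' k) * (\<Sum>k\<in>K. a' k * b k)) =
         (\<Sum>k\<in>K. \<Sum>l\<in>K. (a k * a' l - a l * a' k) * (b k * b' l - b' k * b l))"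
proof -
  let ?T = "\<lambda>k l. a k * a' l * (b k * b' l - b' k * b l)"
  have one: "(\<Sum>k\<in>K. a k * b k) * (\<Sum>k\<in>K. a' k * b' k) - (\<Sum>k\<in>K. a k * b' k) * (\<Sum>k\<in>K. a' k * b k) =
             (\<Sum>k\<in>K. \<Sum>l\<in>K. ?T k l)"
    unfolding sum_product sum_subtractf[symmetric]
    by (intro sum.cong refl) (simp add: algebra_simps)
  \<comment> \<open>Exchanging \<open>k\<close> and \<open>l\<close> flips the sign of the
    \<open>b\<close> minor, so adding the exchanged copy completes \<open>a k * a' l\<close> to the
    \<open>a\<close> minor.\<close>
  have "2 * (\<Sum>k\<in>K. \<Sum>l\<in>K. ?T k l) = (\<Sum>k\<in>K. \<Sum>l\<in>K. ?T k l) + (\<Sum>k\<in>K. \<Sum>l\<in>K. ?T l k)"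
    by (subst (3) sum.swap) simp
  also have "\<dots> = (\<Sum>k\<in>K. \<Sum>l\<in>K. (a k * a' l - a l * a' k) * (b k * b' l - b' k * b l))"
    unfolding sum.distrib[symmetric] by (intro sum.cong refl) (simp add: algebra_simps)
  finally show ?thesis
    unfolding one .
qed

lemma log_concave_conv_pmf:
  assumes "log_concave_pmf P" "log_concave_pmf R"
  shows "log_concave_pmf (conv_pmf P R)"
proof -
  have P: "toeplitz_tp2 (int_mass P)" and R: "toeplitz_tp2 (int_mass R)"
    using assms by (simp_all add: toeplitz_tp2_int_mass_iff)
  have "toeplitz_tp2 (int_mass (conv_pmf P R))"
    unfolding toeplitz_tp2_def
  proof (intro allI impI)
    fix i i' j j' :: int assume *: "i \<le> i' \<and> j \<le> j'"
    define a a' where "a k = int_mass P (i - k)" and "a' k = int_mass P (i' - k)" for k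
    define b b' where "b k = int_mass R (k - j)" and "b' k = int_mass R (k - j')" for k
    have minors: "0 \<le> a k * a' l - a l * a' k" "0 \<le> b k * b' l - b' k * b l" if "k \<le> l" for k l
      using toeplitz_tp2D[OF P, of "i - l" "i - k" "i' - l" "i' - k"]
        toeplitz_tp2D[OF R, of "k - j'" "k - j" "l - j'" "l - j"] that *
      by (simp_all add: a_def a'_def b_def b'_def)
    \<comment> \<open>Both minors change sign when \<open>k\<close> and \<open>l\<close> are
      exchanged, so their product does not.\<close>
    have "0 \<le> (a k * a' l - a l * a' k) * (b k * b' l - b' k * b l)" for k l
    proof (cases "k \<le> l")
      case False
      then have "0 \<le> (a l * a' k - a k * a' l) * (b l * b' k - b' l * b k)"
        by (intro mult_nonneg_nonneg minors) auto
      then show ?thesis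
        by (simp add: algebra_simps)
    qed (intro mult_nonneg_nonneg minors)
    \<comment> \<open>Since \<open>i \<le> i'\<close> and \<open>j \<le> j'\<close>, the range
      \<open>{j..i'}\<close> contains the summation ranges of all four entries.\<close>
    then have "0 \<le> (\<Sum>k\<in>{j..i'}. \<Sum>l\<in>{j..i'}. (a k * a' l - a l * a' k) * (b k * b' l - b' k * b l))"
      by (intro sum_nonneg)
    moreover have "int_mass (conv_pmf P R) (i - j) = (\<Sum>k\<in>{j..i'}. a k * b k)"
      "int_mass (conv_pmf P R) (i' - j') = (\<Sum>k\<in>{j..i'}. a' k * b' k)"
      "int_mass (conv_pmf P R) (i - j') = (\<Sum>k\<in>{j..i'}. a k * b' k)"
      "int_mass (conv_pmf P R) (i' - j) = (\<Sum>k\<in>{j..i'}. a' k * b k)"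
      using * unfolding a_def a'_def b_def b'_def by (intro int_mass_conv_pmf; simp)+
    ultimately show "int_mass (conv_pmf P R) (i - j') * int_mass (conv_pmf P R) (i' - j)
        \<le> int_mass (conv_pmf P R) (i - j) * int_mass (conv_pmf P R) (i' - j')"
      by (simp flip: cauchy_binet_2)
  qed
  then show ?thesis
    by (simp add: toeplitz_tp2_int_mass_iff)
qed

section \<open>Compounding turns sums of counts into convolutions\<close>

lemma log_concave_return_pmf: "log_concave_pmf (return_pmf n)"
  by (auto simp: log_concave_pmf_def pmf_return split: split_indicator)

lemma conv_pmf_assoc: "conv_pmf (conv_pmf P R) S = conv_pmf P (conv_pmf R S)"
  by (simp add: conv_pmf_def pair_pmf_def map_bind_pmf bind_map_pmf bind_assoc_pmf bind_return_pmf
      map_pmf_def add.assoc)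

lemma conv_return_0_pmf [simp]:
  "conv_pmf (return_pmf 0) P = P" "conv_pmf P (return_pmf 0) = P"
  by (simp_all add: conv_pmf_def pair_return_pmf1 pair_return_pmf2 pmf.map_comp comp_def)

lemma conv_power_pmf_add:
  "conv_power_pmf Q (m + n) = conv_pmf (conv_power_pmf Q m) (conv_power_pmf Q n)"
  by (induction m) (simp_all add: conv_pmf_assoc)

text \<open>Given counts \<open>m\<close> and \<open>n\<close>, a sum of \<open>m + n\<close> copies
  of \<open>Q\<close> splits into independent blocks of sizes \<open>m\<close> and
  \<open>n\<close>.\<close>

lemma compound_conv_pmf:
  "compound_pmf Q (conv_pmf P R) = conv_pmf (compound_pmf Q P) (compound_pmf Q R)"
proof -
  have "conv_pmf (compound_pmf Q P) (compound_pmf Q R) =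
      bind_pmf P (\<lambda>m. bind_pmf (conv_power_pmf Q m) (\<lambda>x.
        bind_pmf R (\<lambda>n. bind_pmf (conv_power_pmf Q n) (\<lambda>y. return_pmf (x + y)))))"
    by (simp add: compound_pmf_def conv_pmf_def pair_pmf_def map_pmf_def bind_assoc_pmf
        bind_return_pmf)
  \<comment> \<open>The first block and the second count are independent, so both counts may be
    drawn first.\<close>
  also have "\<dots> = bind_pmf P (\<lambda>m. bind_pmf R (\<lambda>n. bind_pmf (conv_power_pmf Q m) (\<lambda>x.
        bind_pmf (conv_power_pmf Q n) (\<lambda>y. return_pmf (x + y)))))"
    by (subst bind_commute_pmf) simp
  also have "\<dots> = compound_pmf Q (conv_pmf P R)"
    by (simp add: compound_pmf_def conv_pmf_def pair_pmf_def map_pmf_def bind_assoc_pmf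
        bind_return_pmf conv_power_pmf_add)
  finally show ?thesis by simp
qed

text \<open>A count in {0, 1} selects the point mass at 0 or one copy of \<open>Q\<close>. This
  identifies the convolution factors in (ii) with the distributions of (i).\<close>

lemma compound_bernoulli_pmf:
  "compound_pmf Q (map_pmf of_bool (bernoulli_pmf p)) = cbern_pmf p Q"
  unfolding compound_pmf_def cbern_pmf_def pair_pmf_def map_bind_pmf bind_map_pmf
  by (intro bind_pmf_cong refl)
     (auto simp: map_pmf_def bind_assoc_pmf bind_return_pmf bind_return_pmf')

lemma bernoulli_sum_pmf_Suc:
  "bernoulli_sum_pmf (Suc n) p =
     conv_pmf (map_pmf of_bool (bernoulli_pmf (p (Suc n)))) (bernoulli_sum_pmf n p)"
proof -
  have "{1..Suc n} = insert (Suc n) {1..n}" by auto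
  then have "bernoulli_sum_pmf (Suc n) p =
      map_pmf (\<lambda>B. \<Sum>i\<in>insert (Suc n) {1..n}. of_bool (B i))
        (map_pmf (\<lambda>(b, B). B(Suc n := b))
          (pair_pmf (bernoulli_pmf (p (Suc n))) (Pi_pmf {1..n} False (\<lambda>i. bernoulli_pmf (p i)))))"
    by (simp add: bernoulli_sum_pmf_def Pi_pmf_insert)
  \<comment> \<open>Updating coordinate \<open>Suc n\<close> leaves the sum over
    \<open>{1..n}\<close> unchanged.\<close>
  also have "\<dots> = map_pmf (\<lambda>(b, B). of_bool b + (\<Sum>i\<in>{1..n}. of_bool (B i)))
        (pair_pmf (bernoulli_pmf (p (Suc n))) (Pi_pmf {1..n} False (\<lambda>i. bernoulli_pmf (p i))))"
    unfolding pmf.map_comp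
    by (intro map_pmf_cong refl) (auto simp del: sum_of_bool_eq intro!: sum.cong)
  also have "\<dots> = conv_pmf (map_pmf of_bool (bernoulli_pmf (p (Suc n)))) (bernoulli_sum_pmf n p)"
    by (simp add: conv_pmf_def bernoulli_sum_pmf_def pair_map_pmf1 pair_map_pmf2 pmf.map_comp
        comp_def case_prod_unfold)
  finally show ?thesis .
qed

lemma log_concave_compound_bernoulli_sum_pmf:
  assumes "\<And>i. i \<in> {1..n} \<Longrightarrow> log_concave_pmf (cbern_pmf (p i) Q)"
  shows "log_concave_pmf (compound_pmf Q (bernoulli_sum_pmf n p))"
  using assms
proof (induction n)
  case 0
  then show ?case
    by (simp add: bernoulli_sum_pmf_def compound_pmf_def bind_return_pmf log_concave_return_pmf)
next
  case (Suc n)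
  then show ?case
    by (simp add: bernoulli_sum_pmf_Suc compound_conv_pmf compound_bernoulli_pmf
        log_concave_conv_pmf)
qed

section \<open>Compound Bernoulli distributions and the threshold\<close>

lemma pmf_cbern_pmf_0:
  assumes "0 \<le> p" "p \<le> 1" "pmf Q 0 = 0"
  shows "pmf (cbern_pmf p Q) 0 = 1 - p"
proof -
  have "cbern_pmf p Q = bind_pmf (bernoulli_pmf p) (\<lambda>b. if b then Q else return_pmf 0)"
    unfolding cbern_pmf_def pair_pmf_def map_bind_pmf
    by (intro bind_pmf_cong refl) (auto simp: map_bind_pmf bind_return_pmf bind_return_pmf')
  then show ?thesis
    using assms by (simp add: pmf_bind)
qed

lemma cbern_pmf_0: "cbern_pmf 0 Q = return_pmf 0"
proof -
  have "bernoulli_pmf 0 = return_pmf False"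
    by (intro pmf_eqI) (auto simp: pmf_return split: split_indicator)
  then show ?thesis
    by (simp add: cbern_pmf_def pair_return_pmf1 pmf.map_comp comp_def)
qed

lemma cbern_pmf_1: "cbern_pmf 1 Q = Q"
proof -
  have "bernoulli_pmf 1 = return_pmf True"
    by (intro pmf_eqI) (auto simp: pmf_return split: split_indicator)
  then show ?thesis
    by (simp add: cbern_pmf_def pair_return_pmf1 pmf.map_comp comp_def)
qed

text \<open>Clearing denominators gives the log-concavity inequality of \<open>cbern_pmf p Q\<close>
  at 1, divided by \<open>p\<close>. If \<open>pmf Q 2 = 0\<close>, the threshold is 0 and both
  sides hold.\<close>

lemma cbern_threshold_le_iff:
  assumes "0 \<le> p" "p \<le> 1" "pmf Q 1 > 0"
  shows "cbern_threshold Q \<le> ennreal p \<longleftrightarrow> (1 - p) * pmf Q 2 \<le> p * (pmf Q 1)\<^sup>2"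
proof (cases "pmf Q 2 = 0")
  case True
  then show ?thesis
    using assms by (simp add: cbern_threshold_eq_0)
next
  case False
  then have q2: "pmf Q 2 > 0"
    by (simp add: order_less_le)
  then have "pmf Q 2 + (pmf Q 1)\<^sup>2 > 0"
    by (intro add_pos_nonneg) auto
  moreover have "1 / (1 + (pmf Q 1)\<^sup>2 / pmf Q 2) = pmf Q 2 / (pmf Q 2 + (pmf Q 1)\<^sup>2)"
    using q2 by (simp add: divide_simps)
  ultimately show ?thesis
    using assms by (simp add: cbern_threshold_real[OF q2] pos_divide_le_eq algebra_simps)
qed

lemma log_concave_cbern_pmf_iff:
  assumes "pmf Q 0 = 0" "log_concave_pmf Q" "0 < p" "p \<le> 1"
  shows "log_concave_pmf (cbern_pmf p Q) \<longleftrightarrow> cbern_threshold Q \<le> ennreal p"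
proof (cases "p = 1")
  case True
  have "cbern_threshold Q \<le> 1"
  proof (cases "pmf Q 1 = 0")
    case False
    then show ?thesis
      using cbern_threshold_le_iff[of 1 Q] by (simp add: order_less_le)
  qed (simp add: cbern_threshold_eq_1)
  then show ?thesis
    using True assms(2) by (simp add: cbern_pmf_1)
next
  case False
  then have "p < 1"
    using assms by simp
  have mass0: "pmf (cbern_pmf p Q) 0 = 1 - p"
    using assms by (intro pmf_cbern_pmf_0) auto
  have mass: "pmf (cbern_pmf p Q) x = p * pmf Q x" if "x \<ge> 1" for x
    using assms that by (intro pmf_cbern_pmf) auto
  have supp: "x \<in> set_pmf (cbern_pmf p Q) \<longleftrightarrow> x = 0 \<or> x \<in> set_pmf Q" for x
    using mass[of x] mass0 \<open>p < 1\<close> \<open>0 < p\<close> by (cases "x = 0") (auto simp: set_pmf_iff)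
  show ?thesis
  proof (cases "pmf Q 1 = 0")
    \<comment> \<open>Here 0 and some \<open>z > 1\<close> are in the support but 1 is not, while
      the threshold is 1 and \<open>p < 1\<close>: both sides fail.\<close>
    case True
    obtain z where z: "z \<in> set_pmf Q"
      using set_pmf_not_empty[of Q] by blast
    then have "z \<noteq> 0"
      using assms(1) by (metis set_pmf_iff)
    have "\<not> log_concave_pmf (cbern_pmf p Q)"
    proof
      assume "log_concave_pmf (cbern_pmf p Q)"
      then have "1 \<in> set_pmf (cbern_pmf p Q)"
        using supp z \<open>z \<noteq> 0\<close> unfolding log_concave_pmf_def
        by (metis One_nat_def Suc_leI le0 neq0_conv)
      then show False
        using True supp by (auto simp: set_pmf_iff)
    qed
    then show ?thesis
      using True \<open>p < 1\<close> \<open>0 < p\<close> by (simp add: cbern_threshold_eq_1)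
  next
    case False
    then have q1: "1 \<in> set_pmf Q"
      by (simp add: set_pmf_iff)
    have at_1: "pmf (cbern_pmf p Q) (1 + 1) * pmf (cbern_pmf p Q) (1 - 1) \<le> (pmf (cbern_pmf p Q) 1)\<^sup>2
        \<longleftrightarrow> (1 - p) * pmf Q 2 \<le> p * (pmf Q 1)\<^sup>2"
    proof -
      have "pmf (cbern_pmf p Q) (1 + 1) * pmf (cbern_pmf p Q) (1 - 1) = p * ((1 - p) * pmf Q 2)"
        by (simp add: mass mass0 numeral_2_eq_2)
      moreover have "(pmf (cbern_pmf p Q) 1)\<^sup>2 = p * (p * (pmf Q 1)\<^sup>2)"
        by (simp add: mass power2_eq_square)
      ultimately show ?thesis
        using \<open>0 < p\<close> by simp
    qed
    \<comment> \<open>For \<open>x \<ge> 2\<close> all three masses are those of \<open>Q\<close>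
      scaled by \<open>p\<close>.\<close>
    have above_1: "pmf (cbern_pmf p Q) (x + 1) * pmf (cbern_pmf p Q) (x - 1) \<le> (pmf (cbern_pmf p Q) x)\<^sup>2"
      if "x \<ge> 2" for x
    proof -
      have "pmf Q (x + 1) * pmf Q (x - 1) \<le> (pmf Q x)\<^sup>2"
        using assms(2) that unfolding log_concave_pmf_def by auto
      then have "p\<^sup>2 * (pmf Q (x + 1) * pmf Q (x - 1)) \<le> p\<^sup>2 * (pmf Q x)\<^sup>2"
        by (rule mult_left_mono) simp
      then show ?thesis
        using that by (simp add: mass power_mult_distrib power2_eq_square mult_ac)
    qed
    \<comment> \<open>The support is that of \<open>Q\<close> with 0 adjoined, and 1 in the support
      of \<open>Q\<close> leaves no gap.\<close>
    have interval: "y \<in> set_pmf (cbern_pmf p Q)" if "z \<in> set_pmf (cbern_pmf p Q)" "y \<le> z" for y z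
    proof (cases "y = 0")
      case False
      then have "z \<in> set_pmf Q" "1 \<le> y"
        using that supp by auto
      then show ?thesis
        using assms(2) q1 \<open>y \<le> z\<close> unfolding supp log_concave_pmf_def by blast
    qed (simp add: supp)
    have "log_concave_pmf (cbern_pmf p Q) \<longleftrightarrow> (\<forall>x\<ge>1. pmf (cbern_pmf p Q) (x + 1) * pmf (cbern_pmf p Q) (x - 1)
        \<le> (pmf (cbern_pmf p Q) x)\<^sup>2)"
      using interval unfolding log_concave_pmf_def by blast
    also have "\<dots> \<longleftrightarrow> (1 - p) * pmf Q 2 \<le> p * (pmf Q 1)\<^sup>2"
      unfolding at_1[symmetric] using above_1
      by (metis Suc_1 Suc_leI le_neq_implies_less One_nat_def order_refl)
    also have "\<dots> \<longleftrightarrow> cbern_threshold Q \<le> ennreal p"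
      using assms q1 by (intro cbern_threshold_le_iff[symmetric]) (auto simp: pmf_positive)
    finally show ?thesis .
  qed
qed

text \<open>The converse in (i) excludes \<open>p = 0\<close>: the point mass at 0 is log-concave,
  yet the threshold is positive whenever \<open>pmf Q 2 > 0\<close>.\<close>

theorem lemma4p1:
  fixes Q :: "nat pmf"
  assumes "pmf Q 0 = 0" and "log_concave_pmf Q"
  shows
    "(\<forall>p::real. 0 \<le> p \<and> p \<le> 1 \<longrightarrow>
        (ennreal p \<ge> cbern_threshold Q \<longrightarrow> log_concave_pmf (cbern_pmf p Q)) \<and>
        (log_concave_pmf (cbern_pmf p Q) \<and> p \<noteq> 0 \<longrightarrow> ennreal p \<ge> cbern_threshold Q)) \<and>
     (\<forall>(n::nat) (p::nat \<Rightarrow> real).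
        (\<forall>i\<in>{1..n}. 0 \<le> p i \<and> p i \<le> 1 \<and> ennreal (p i) \<ge> cbern_threshold Q)
        \<longrightarrow> log_concave_pmf (compound_pmf Q (bernoulli_sum_pmf n p)))"
proof -
  have if_threshold: "log_concave_pmf (cbern_pmf p Q)"
    if "0 \<le> p" "p \<le> 1" "cbern_threshold Q \<le> ennreal p" for p
    using that log_concave_cbern_pmf_iff[OF assms, of p]
    by (cases "p = 0") (simp_all add: cbern_pmf_0 log_concave_return_pmf)
  moreover have "cbern_threshold Q \<le> ennreal p"
    if "0 \<le> p" "p \<le> 1" "log_concave_pmf (cbern_pmf p Q)" "p \<noteq> 0" for p
    using that log_concave_cbern_pmf_iff[OF assms, of p] by simp
  ultimately show ?thesis
    by (auto intro: log_concave_compound_bernoulli_sum_pmf)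
qed

end
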